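(* Let $(X,d,\mu)$ be a metric measure space, where $\mu$ is a nontrivial Borel regular measure that is finite on bounded sets and positive on nonempty open sets. Suppose that $X$ is separable. Let $u,g\in L^1_{\mathrm{loc}}(X)$ and suppose that $g$ is a local Hajłasz gradient of $u$. Then there exist $\widetilde u,\widetilde g\in L^1_{\mathrm{loc}}(X)$ such that $\widetilde u=u$ and $\widetilde g=g$ $\mu$-almost everywhere and $4\widetilde g$ is an upper gradient of $\widetilde u$.
   Context: Gradients are allowed to take values in $[0,\infty]$. $L^1_{\mathrm{loc}}(X)$ denotes the locally integrable functions on $X$. Local Hajłasz gradient: given a measurable function $u$ on $X$, a non-negative measurable function $g$ on $X$ is a local Hajłasz gradient of $u$ if for each $z\in X$ there exist an open set $U_z\ni z$ and a set $E_z\subset U_z$ with $\mu(E_z)=0$ such that $|u(x)-u(y)|\le d(x,y)[g(x)+g(y)]$ for all $x,y\in U_z\setminus E_z$. Upper gradient: a rectifiable curve is a continuous map from a compact interval into $X$ with finite length. A non-negative Borel function $g$ on $X$ is an upper gradient of a (pointwise defined) measurable function $u$ on $X$ if $|u(\gamma(a))-u(\gamma(b))|\le\int_\gamma g(s)\,ds$ for every non-constant rectifiable curve $\gamma:[a,b]\to X$, where the integral is with respect to arc length. *)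

theory Defs
  imports "HOL-Analysis.Analysis"
begin

text \<open>
  As is usual in analysis on metric spaces, a Borel regular measure on \<open>X\<close> is an outer measure
  \<open>\<mu>\<close> on all subsets of \<open>X\<close> for which Borel sets are Caratheodory measurable and every set
  is contained in a Borel set of the same measure. Measurability, integrals and ``almost everywhere''
  refer to the restriction of \<open>\<mu>\<close> to its Caratheodory measurable sets.
\<close>

definition borel_regular_measure :: "('a::topological_space set \<Rightarrow> ennreal) \<Rightarrow> bool" where
  "borel_regular_measure \<mu> \<longleftrightarrow>
     outer_measure_space UNIV \<mu> \<and>
     sets borel \<subseteq> lambda_system UNIV UNIV \<mu> \<and>
     (\<forall>A. \<exists>B\<in>sets borel. A \<subseteq> B \<and> \<mu> B = \<mu> A)"

definition caratheodory_measure :: "('a set \<Rightarrow> ennreal) \<Rightarrow> 'a measure" where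
  "caratheodory_measure \<mu> = measure_of UNIV (lambda_system UNIV UNIV \<mu>) \<mu>"

lemma measure_space_caratheodory:
  assumes "outer_measure_space UNIV \<mu>"
  shows "measure_space UNIV (lambda_system UNIV UNIV \<mu>) \<mu>"
  using sigma_algebra.caratheodory_lemma[OF sigma_algebra_Pow, of UNIV \<mu>] assms by simp

lemma space_caratheodory_measure [simp]: "space (caratheodory_measure \<mu>) = UNIV"
  by (simp add: caratheodory_measure_def space_measure_of_conv)

lemma sets_caratheodory_measure:
  assumes "outer_measure_space UNIV \<mu>"
  shows "sets (caratheodory_measure \<mu>) = lambda_system UNIV UNIV \<mu>"
  using measure_space_caratheodory[OF assms]
  by (simp add: caratheodory_measure_def measure_space_def sigma_algebra.sigma_sets_eq)

lemma emeasure_caratheodory_measure: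
  assumes "outer_measure_space UNIV \<mu>" "A \<in> lambda_system UNIV UNIV \<mu>"
  shows "emeasure (caratheodory_measure \<mu>) A = \<mu> A"
  using measure_space_caratheodory[OF assms(1)] assms(2)
  by (simp add: caratheodory_measure_def measure_space_def emeasure_measure_of_sigma)

lemma null_sets_caratheodory_measure:
  assumes "outer_measure_space UNIV \<mu>"
  shows "E \<in> null_sets (caratheodory_measure \<mu>) \<longleftrightarrow> \<mu> E = 0"
proof
  assume "E \<in> null_sets (caratheodory_measure \<mu>)"
  then show "\<mu> E = 0"
    using assms
    by (metis emeasure_caratheodory_measure null_setsD1 null_setsD2 sets_caratheodory_measure)
next
  assume E: "\<mu> E = 0"
  have mono: "\<mu> A \<le> \<mu> B" if "A \<subseteq> B" for A B
    using assms that by (auto simp: outer_measure_space_def increasing_def)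
  have "subadditive UNIV \<mu>"
    using ring_of_sets.countably_subadditive_subadditive[of UNIV UNIV \<mu>] assms
      algebra.axioms(1)[OF algebra_Pow, of UNIV]
    by (simp add: outer_measure_space_def)
  then have "\<mu> A \<le> \<mu> (E \<inter> A) + \<mu> ((UNIV - E) \<inter> A)" for A
    using subadditiveD[of UNIV \<mu> "E \<inter> A" "(UNIV - E) \<inter> A"]
    by (simp add: Int_Un_distrib2[symmetric] Int_assoc[symmetric] Un_Diff_cancel
        flip: Compl_eq_Diff_UNIV)
  moreover have "\<mu> (E \<inter> A) = 0" for A
    using mono[of "E \<inter> A" E] E by auto
  moreover have "\<mu> ((UNIV - E) \<inter> A) \<le> \<mu> A" for A
    by (rule mono) blast
  ultimately have "E \<in> lambda_system UNIV UNIV \<mu>"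
    by (simp add: lambda_system_def antisym)
  then show "E \<in> null_sets (caratheodory_measure \<mu>)"
    using assms E by (auto simp: null_sets_def sets_caratheodory_measure emeasure_caratheodory_measure)
qed

definition locally_integrable :: "'a::metric_space measure \<Rightarrow> ('a \<Rightarrow> real) \<Rightarrow> bool" where
  "locally_integrable M u \<longleftrightarrow>
     u \<in> borel_measurable M \<and> (\<forall>x. \<exists>r>0. set_integrable M (ball x r) u)"

definition locally_integrable_ennreal :: "'a::metric_space measure \<Rightarrow> ('a \<Rightarrow> ennreal) \<Rightarrow> bool" where
  "locally_integrable_ennreal M g \<longleftrightarrow>
     g \<in> borel_measurable M \<and> (\<forall>x. \<exists>r>0. (\<integral>\<^sup>+y\<in>ball x r. g y \<partial>M) < \<infinity>)"

definition local_Hajlasz_gradient ::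
  "'a::metric_space measure \<Rightarrow> ('a \<Rightarrow> ennreal) \<Rightarrow> ('a \<Rightarrow> real) \<Rightarrow> bool" where
  "local_Hajlasz_gradient M g u \<longleftrightarrow>
     u \<in> borel_measurable M \<and> g \<in> borel_measurable M \<and>
     (\<forall>z. \<exists>U E. open U \<and> z \<in> U \<and> E \<subseteq> U \<and> E \<in> null_sets M \<and>
        (\<forall>x\<in>U - E. \<forall>y\<in>U - E. ennreal \<bar>u x - u y\<bar> \<le> ennreal (dist x y) * (g x + g y)))"

definition curve_length :: "(real \<Rightarrow> 'a::metric_space) \<Rightarrow> real \<Rightarrow> real \<Rightarrow> ennreal" where
  "curve_length \<gamma> a b =
     (SUP (t, n) \<in> {(t :: nat \<Rightarrow> real, n). t 0 = a \<and> t n = b \<and> mono_on {..n} t}.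
        \<Sum>i<n. ennreal (dist (\<gamma> (t i)) (\<gamma> (t (Suc i)))))"

definition rectifiable_curve :: "(real \<Rightarrow> 'a::metric_space) \<Rightarrow> real \<Rightarrow> real \<Rightarrow> bool" where
  "rectifiable_curve \<gamma> a b \<longleftrightarrow>
     a \<le> b \<and> continuous_on {a..b} \<gamma> \<and> curve_length \<gamma> a b < \<infinity>"

text \<open>
  The arc-length parametrization of a rectifiable curve, meaningful for parameters between \<open>0\<close>
  and the length of the curve. The described point exists because the length of \<open>\<gamma>\<close> on
  \<open>[a, t]\<close> depends continuously on \<open>t\<close>; it is unique because \<open>\<gamma>\<close> is constant wherever this
  length is.
\<close>

definition arclength_param ::
  "(real \<Rightarrow> 'a::metric_space) \<Rightarrow> real \<Rightarrow> real \<Rightarrow> real \<Rightarrow> 'a" where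
  "arclength_param \<gamma> a b s =
     (THE x. \<exists>t\<in>{a..b}. curve_length \<gamma> a t = ennreal s \<and> \<gamma> t = x)"

definition arclength_integral ::
  "('a::metric_space \<Rightarrow> ennreal) \<Rightarrow> (real \<Rightarrow> 'a) \<Rightarrow> real \<Rightarrow> real \<Rightarrow> ennreal" where
  "arclength_integral g \<gamma> a b =
     (\<integral>\<^sup>+s\<in>{0..enn2real (curve_length \<gamma> a b)}. g (arclength_param \<gamma> a b s) \<partial>lborel)"

definition upper_gradient ::
  "'a::metric_space measure \<Rightarrow> ('a \<Rightarrow> ennreal) \<Rightarrow> ('a \<Rightarrow> real) \<Rightarrow> bool" where
  "upper_gradient M g u \<longleftrightarrow>
     u \<in> borel_measurable M \<and> g \<in> borel_measurable borel \<and>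
     (\<forall>\<gamma> a b. rectifiable_curve \<gamma> a b \<and> \<not> \<gamma> constant_on {a..b} \<longrightarrow>
        ennreal \<bar>u (\<gamma> a) - u (\<gamma> b)\<bar> \<le> arclength_integral g \<gamma> a b)"

end

theory Submission
  imports Defs
begin

text \<open>
  Modify \<open>g\<close> on a null set so that it is Borel and infinite at every exceptional point; then the
  inequality \<open>\<bar>u x - u y\<bar> \<le> d x y * (g x + g y)\<close> holds locally without exceptions. Along a path \<open>p\<close>
  parametrized by arc length one telescopes this inequality over a uniform grid; averaging over
  translates of the grid yields \<open>\<bar>u (p b) - u (p a)\<bar> \<le> 2 * \<integral> g \<circ> p\<close> whenever \<open>g\<close> is finite at both
  end points. At a point where \<open>g\<close> is infinite, the new value of \<open>u\<close> is forced by the paths of finite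
  integral starting there, and joining two such paths shows that they impose compatible
  conditions. All of this changes \<open>u\<close> only on a null set.
\<close>

text \<open>No exceptional set is allowed here, because a curve may lie entirely inside a null set.
  Bad points can still be absorbed by letting \<open>g\<close> be \<infinity> there.\<close>

definition everywhere_local_Hajlasz :: "('a::metric_space \<Rightarrow> ennreal) \<Rightarrow> ('a \<Rightarrow> real) \<Rightarrow> bool" where
  "everywhere_local_Hajlasz g u \<longleftrightarrow>
     (\<forall>z. \<exists>U. open U \<and> z \<in> U \<and>
        (\<forall>x\<in>U. \<forall>y\<in>U. ennreal \<bar>u x - u y\<bar> \<le> ennreal (dist x y) * (g x + g y)))"

section \<open>Borel representatives without exceptional sets\<close>

text \<open>Lindelof property: balls with centre in a countable dense set and radius
  \<open>1 / real (Suc n)\<close> are countable in number, and those contained in some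
  \<open>W z\<close> cover the space. Since \<open>P\<close> need not pass to subsets, the cover
  consists of one chosen \<open>W z\<close> for each such ball, not of the balls.\<close>

lemma separable_space_countable_subcover:
  fixes P :: "'a::metric_space set \<Rightarrow> bool"
  assumes sep: "separable_space (euclidean :: 'a topology)"
    and loc: "\<And>z. \<exists>U. open U \<and> z \<in> U \<and> P U"
  obtains F where "countable F" "\<And>U. U \<in> F \<Longrightarrow> open U \<and> P U" "\<Union>F = UNIV"
proof -
  obtain C :: "'a set" where C: "countable C" "closure C = UNIV"
    using sep by (auto simp: separable_space_def)
  obtain W where W: "\<And>z. open (W z) \<and> z \<in> W z \<and> P (W z)"
    using loc by metis
  define R where "R = {(d, n). d \<in> C \<and> (\<exists>z. ball d (1 / real (Suc n)) \<subseteq> W z)}"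
  define f where "f = (\<lambda>(d, n). W (SOME z. ball d (1 / real (Suc n)) \<subseteq> W z))"
  have f: "ball d (1 / real (Suc n)) \<subseteq> f (d, n)" if "(d, n) \<in> R" for d n
    using that someI_ex[of "\<lambda>z. ball d (1 / real (Suc n)) \<subseteq> W z"] by (auto simp: R_def f_def)
  have "R \<subseteq> C \<times> UNIV" by (auto simp: R_def)
  then have "countable R" using C by (meson countable_SIGMA countable_subset countableI_type)
  moreover have "\<exists>r\<in>R. z \<in> f r" for z
  proof -
    obtain e where e: "e > 0" "ball z e \<subseteq> W z" using W openE by metis
    \<comment> \<open>Half of \<open>e\<close> pays for the distance from \<open>z\<close> to the
      centre \<open>d\<close>, the other half for the radius of the ball around
      \<open>d\<close>.\<close>
    obtain n where n: "1 / real (Suc n) < e / 2" using e nat_approx_posE[of "e / 2"] by auto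
    have "z \<in> closure C" using C by simp
    then obtain d where d: "d \<in> C" "dist d z < 1 / real (Suc n)"
      unfolding closure_approachable by (metis of_nat_0_less_iff zero_less_Suc zero_less_divide_1_iff)
    have "ball d (1 / real (Suc n)) \<subseteq> ball z e"
    proof
      fix x assume "x \<in> ball d (1 / real (Suc n))"
      then show "x \<in> ball z e"
        using d n dist_triangle[of z x d] by (simp add: dist_commute)
    qed
    then have "(d, n) \<in> R" using d e by (auto simp: R_def)
    then show ?thesis using f[of d n] d by auto
  qed
  ultimately show thesis
    using W by (intro that[of "f ` R"]) (auto simp: f_def)
qed

text \<open>Preimages under \<open>f\<close> and \<open>g\<close> differ by a subset of a null set,
  which completeness makes measurable. This is how a function redefined on a null set stays
  measurable.\<close>

lemma (in complete_measure) measurable_AE_eq: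
  assumes f: "f \<in> measurable M N" and ae: "AE x in M. g x = f x" and g: "g \<in> space M \<rightarrow> space N"
  shows "g \<in> measurable M N"
proof (rule measurableI)
  fix A assume A: "A \<in> sets N"
  show "g -` A \<inter> space M \<in> sets M"
  proof (rule in_sets_AE)
    show "f -` A \<inter> space M \<in> sets M" using f A by (rule measurable_sets)
    show "AE x in M. x \<in> f -` A \<inter> space M \<longleftrightarrow> x \<in> g -` A \<inter> space M"
      using ae by eventually_elim auto
  qed simp
qed (use g in auto)

section \<open>Measures with Borel hulls of equal measure\<close>

context
  fixes M :: "'a::metric_space measure"
  assumes space_M: "space M = UNIV"
    and borel_sets: "sets borel \<subseteq> sets M"
    and hull: "\<And>A. A \<in> sets M \<Longrightarrow> \<exists>B\<in>sets borel. A \<subseteq> B \<and> emeasure M B = emeasure M A"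
    and finite_bounded: "\<And>A. bounded A \<Longrightarrow> A \<in> sets M \<Longrightarrow> emeasure M A < \<infinity>"
begin

lemma id_measurable_borel: "(\<lambda>x. x) \<in> measurable M borel"
  using borel_sets space_M by (auto intro!: measurableI)

lemma borel_null_hull:
  assumes "A \<in> null_sets M"
  obtains B where "A \<subseteq> B" "B \<in> sets borel" "B \<in> null_sets M"
  using hull[of A] assms borel_sets by (auto simp: null_sets_def)

text \<open>A bounded piece of \<open>A\<close> has a Borel hull \<open>C\<close> whose surplus is
  null and hence lies in a Borel null set \<open>D\<close>. So \<open>C - D\<close> is a Borel
  subset of the piece, and the rest of the piece lies in \<open>D\<close>.\<close>

lemma sets_subset_completion_borel: "sets M \<subseteq> sets (completion (distr M borel (\<lambda>x. x)))"
proof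
  let ?B = "distr M borel (\<lambda>x. x)"
  fix A assume A: "A \<in> sets M"
  have null: "N \<in> null_sets ?B" if "N \<in> sets borel" "N \<in> null_sets M" for N
    using that by (auto simp: null_sets_def emeasure_distr[OF id_measurable_borel] space_M)
  have "A \<inter> ball x (real n) \<in> sets (completion ?B)" for x n
  proof -
    let ?A = "A \<inter> ball x (real n)"
    have "ball x (real n) \<in> sets M" using borel_sets borel_open[OF open_ball] by blast
    then have As: "?A \<in> sets M" using A by (rule sets.Int[rotated])
    then obtain C where C: "C \<in> sets borel" "?A \<subseteq> C" "emeasure M C = emeasure M ?A"
      using hull by metis
    \<comment> \<open>Finiteness is what lets equality of measures be subtracted; it is the reason
      for cutting \<open>A\<close> by balls.\<close>
    have "emeasure M ?A < \<infinity>" using As by (intro finite_bounded) (auto intro: bounded_subset)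
    then have "C - ?A \<in> null_sets M"
      using C As borel_sets by (auto simp: null_sets_def emeasure_Diff)
    then obtain D where D: "C - ?A \<subseteq> D" "D \<in> sets borel" "D \<in> null_sets M"
      by (rule borel_null_hull)
    show ?thesis
    proof (rule sets_completionI)
      show "?A = (C - D) \<union> (?A \<inter> D)" using C D by auto
      show "D \<in> null_sets ?B" using D null by auto
      show "C - D \<in> sets ?B" using C D by auto
    qed simp
  qed
  \<comment> \<open>Any centre serves here; \<open>undefined\<close> is just some point of the
    space.\<close>
  then have "(\<Union>n. A \<inter> ball undefined (real n)) \<in> sets (completion ?B)" by blast
  also have "(\<Union>n. A \<inter> ball undefined (real n)) = A"
    using reals_Archimedean2 by auto
  finally show "A \<in> sets (completion ?B)" .
qed

lemma exists_borel_AE_eq: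
  fixes f :: "'a \<Rightarrow> ennreal"
  assumes "f \<in> borel_measurable M"
  obtains f' where "f' \<in> borel_measurable borel" "AE x in M. f x = f' x"
proof -
  have "f \<in> borel_measurable (completion (distr M borel (\<lambda>x. x)))"
    using assms sets_subset_completion_borel by (auto simp: measurable_def space_M)
  then obtain f' where "f' \<in> borel_measurable (distr M borel (\<lambda>x. x))"
      "AE x in distr M borel (\<lambda>x. x). f x = f' x"
    using completion_ex_borel_measurable by blast
  then show thesis
    using that AE_distrD[OF id_measurable_borel] by auto
qed

lemma locally_integrable_ennreal_AE_finite:
  assumes sep: "separable_space (euclidean :: 'a topology)" and g: "locally_integrable_ennreal M g"
  shows "AE x in M. g x < \<infinity>"
proof -
  have [measurable]: "g \<in> borel_measurable M" using g by (simp add: locally_integrable_ennreal_def)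
  obtain F where F: "countable F" "\<And>U. U \<in> F \<Longrightarrow> open U \<and> (\<integral>\<^sup>+y\<in>U. g y \<partial>M) < \<infinity>" "\<Union>F = UNIV"
    using separable_space_countable_subcover[OF sep, of "\<lambda>U. (\<integral>\<^sup>+y\<in>U. g y \<partial>M) < \<infinity>"] g
    unfolding locally_integrable_ennreal_def by (metis centre_in_ball open_ball)
  have "AE x in M. x \<in> U \<longrightarrow> g x < \<infinity>" if "U \<in> F" for U
  proof -
    have "U \<in> sets M" using F(2)[OF that] borel_sets by (auto simp: borel_open)
    then have "AE x in M. g x * indicator U x \<noteq> \<infinity>"
      using F(2)[OF that] by (intro nn_integral_noteq_infinite) auto
    then show ?thesis by eventually_elim (auto simp: less_top split: split_indicator_asm)
  qed
  then have "AE x in M. \<forall>U\<in>F. x \<in> U \<longrightarrow> g x < \<infinity>"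
    by (subst AE_ball_countable[OF F(1)]) blast
  then show ?thesis by eventually_elim (use F(3) in blast)
qed

text \<open>The gradient condition gives one exceptional set per point; a countable subcover leaves
  countably many of them, whose union is still null.\<close>

lemma local_Hajlasz_exceptional_set:
  assumes sep: "separable_space (euclidean :: 'a topology)" and g: "local_Hajlasz_gradient M g u"
  obtains E where "E \<in> null_sets M"
    "\<And>z. \<exists>U. open U \<and> z \<in> U \<and>
      (\<forall>x\<in>U - E. \<forall>y\<in>U - E. ennreal \<bar>u x - u y\<bar> \<le> ennreal (dist x y) * (g x + g y))"
proof -
  let ?H = "\<lambda>U E. \<forall>x\<in>U - E. \<forall>y\<in>U - E. ennreal \<bar>u x - u y\<bar> \<le> ennreal (dist x y) * (g x + g y)"
  obtain F where F: "countable F" "\<And>U. U \<in> F \<Longrightarrow> open U \<and> (\<exists>E\<in>null_sets M. ?H U E)" "\<Union>F = UNIV"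
    using separable_space_countable_subcover[OF sep, of "\<lambda>U. \<exists>E\<in>null_sets M. ?H U E"] g
    unfolding local_Hajlasz_gradient_def by (smt (verit, best))
  then obtain E where E: "\<And>U. U \<in> F \<Longrightarrow> E U \<in> null_sets M \<and> ?H U (E U)" by metis
  show thesis
  proof (rule that)
    show "(\<Union>U\<in>F. E U) \<in> null_sets M" using F(1) E by (intro null_sets_UN') auto
    show "\<exists>U. open U \<and> z \<in> U \<and> ?H U (\<Union>U\<in>F. E U)" for z
    proof -
      obtain U where U: "U \<in> F" "z \<in> U" using F(3) by (metis UNIV_I UnionE)
      have "U - (\<Union>U\<in>F. E U) \<subseteq> U - E U" using U(1) by blast
      then have "?H U (\<Union>U\<in>F. E U)" using E[OF U(1)] by (meson subsetD)
      then show ?thesis using F(2)[OF U(1)] U(2) by (intro exI[of _ U]) simp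
    qed
  qed
qed

text \<open>Setting \<open>g = \<infinity>\<close> on a Borel null set containing all exceptional points makes the
  Hajlasz inequality hold without exceptions: it is trivial where the right-hand side is infinite.\<close>

lemma exists_everywhere_local_Hajlasz:
  assumes sep: "separable_space (euclidean :: 'a topology)"
    and int: "locally_integrable_ennreal M g" and H: "local_Hajlasz_gradient M g u"
  obtains g' where "g' \<in> borel_measurable borel" "everywhere_local_Hajlasz g' u"
    "AE x in M. g' x = g x \<and> g' x < \<infinity>"
proof -
  have "g \<in> borel_measurable M" using int by (simp add: locally_integrable_ennreal_def)
  then obtain g0 where g0: "g0 \<in> borel_measurable borel" "AE x in M. g x = g0 x"
    by (rule exists_borel_AE_eq)
  obtain E where E: "E \<in> null_sets M"
    "\<And>z. \<exists>U. open U \<and> z \<in> U \<and>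
      (\<forall>x\<in>U - E. \<forall>y\<in>U - E. ennreal \<bar>u x - u y\<bar> \<le> ennreal (dist x y) * (g x + g y))"
    using local_Hajlasz_exceptional_set[OF sep H] by blast
  have "AE x in M. g x = g0 x \<and> g x < \<infinity> \<and> x \<notin> E"
    using g0(2) locally_integrable_ennreal_AE_finite[OF sep int] AE_not_in[OF E(1)]
    by eventually_elim auto
  then obtain N0 where N0: "N0 \<in> null_sets M" "{x \<in> space M. \<not> (g x = g0 x \<and> g x < \<infinity> \<and> x \<notin> E)} \<subseteq> N0"
    unfolding eventually_ae_filter by blast
  \<comment> \<open>The bad set is enlarged to a Borel null set so that redefining \<open>g0\<close>
    on it keeps the function Borel.\<close>
  obtain N where N: "N0 \<subseteq> N" "N \<in> sets borel" "N \<in> null_sets M"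
    using borel_null_hull[OF N0(1)] .
  have good: "g x = g0 x" "g x < \<infinity>" "x \<notin> E" if "x \<notin> N" for x
    using that N(1) N0(2) by (auto simp: space_M)
  define g' where "g' x = (if x \<in> N then \<infinity> else g0 x)" for x
  show thesis
  proof (rule that)
    show "g' \<in> borel_measurable borel"
      unfolding g'_def using g0(1) N(2) by measurable
    show "AE x in M. g' x = g x \<and> g' x < \<infinity>"
      using AE_not_in[OF N(3)] by eventually_elim (use good in \<open>auto simp: g'_def\<close>)
    show "everywhere_local_Hajlasz g' u"
      unfolding everywhere_local_Hajlasz_def
    proof
      fix z
      obtain U where U: "open U" "z \<in> U"
        "\<forall>x\<in>U - E. \<forall>y\<in>U - E. ennreal \<bar>u x - u y\<bar> \<le> ennreal (dist x y) * (g x + g y)"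
        using E(2)[of z] by (elim exE conjE)
      have "ennreal \<bar>u x - u y\<bar> \<le> ennreal (dist x y) * (g' x + g' y)" if "x \<in> U" "y \<in> U" for x y
      proof -
        \<comment> \<open>The diagonal is a case of its own: there the right-hand side can be
          \<open>0 * \<infinity> = 0\<close>, but the left-hand side vanishes too.\<close>
        consider "x = y" | "x \<noteq> y" "x \<in> N \<or> y \<in> N" | "x \<notin> N" "y \<notin> N" by blast
        then show ?thesis
        proof cases
          case 2
          then have "ennreal (dist x y) * (g' x + g' y) = \<infinity>"
            by (auto simp: g'_def ennreal_mult_eq_top_iff)
          then show ?thesis by simp
        next
          case 3
          then have "x \<in> U - E" "y \<in> U - E" using that good by auto
          then have "ennreal \<bar>u x - u y\<bar> \<le> ennreal (dist x y) * (g x + g y)"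
            using U(3) by blast
          then show ?thesis using 3 good by (simp add: g'_def)
        qed simp
      qed
      then show "\<exists>U. open U \<and> z \<in> U \<and>
          (\<forall>x\<in>U. \<forall>y\<in>U. ennreal \<bar>u x - u y\<bar> \<le> ennreal (dist x y) * (g' x + g' y))"
        using U(1,2) by (intro exI[of _ U]) simp
    qed
  qed
qed

end

text \<open>Supplies the measure assumptions used above for the Caratheodory restriction.
  Completeness holds because every set of outer measure zero is Caratheodory measurable.\<close>

lemma caratheodory_measure_borel_regular:
  fixes \<mu> :: "'a::metric_space set \<Rightarrow> ennreal"
  assumes reg: "borel_regular_measure \<mu>"
  shows "sets borel \<subseteq> sets (caratheodory_measure \<mu>)"
    and "A \<in> sets (caratheodory_measure \<mu>) \<Longrightarrow> emeasure (caratheodory_measure \<mu>) A = \<mu> A"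
    and "A \<in> sets (caratheodory_measure \<mu>) \<Longrightarrow> \<exists>B\<in>sets borel. A \<subseteq> B \<and>
      emeasure (caratheodory_measure \<mu>) B = emeasure (caratheodory_measure \<mu>) A"
    and "complete_measure (caratheodory_measure \<mu>)"
proof -
  let ?M = "caratheodory_measure \<mu>"
  have out: "outer_measure_space UNIV \<mu>" using reg by (simp add: borel_regular_measure_def)
  show sub: "sets borel \<subseteq> sets ?M"
    using reg by (simp add: borel_regular_measure_def sets_caratheodory_measure)
  show em: "emeasure ?M A = \<mu> A" if "A \<in> sets ?M" for A
    using that out by (simp add: sets_caratheodory_measure emeasure_caratheodory_measure)
  show "\<exists>B\<in>sets borel. A \<subseteq> B \<and> emeasure ?M B = emeasure ?M A" if "A \<in> sets ?M" for A
  proof -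
    obtain B where "B \<in> sets borel" "A \<subseteq> B" "\<mu> B = \<mu> A"
      using reg unfolding borel_regular_measure_def by meson
    then show ?thesis using em sub that by (intro bexI[of _ B]) auto
  qed
  show "complete_measure ?M"
  proof
    fix A B assume "B \<subseteq> A" "A \<in> null_sets ?M"
    then have "\<mu> B \<le> \<mu> A" "\<mu> A = 0"
      using out increasingD[of UNIV \<mu> B A]
      by (simp_all add: outer_measure_space_def null_sets_caratheodory_measure)
    then have "B \<in> null_sets ?M" using out by (simp add: null_sets_caratheodory_measure)
    then show "B \<in> sets ?M" by auto
  qed
qed

section \<open>Paths of finite integral\<close>

text \<open>Lebesgue number argument: preimages of the good neighbourhoods cover the compact
  interval, so some radius \<open>r\<close> works at all its points. The Lipschitz bound then
  replaces the distance in \<open>X\<close> by the parameter distance.\<close>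

lemma everywhere_local_Hajlasz_uniform:
  fixes p :: "real \<Rightarrow> 'a::metric_space"
  assumes H: "everywhere_local_Hajlasz g u" and p: "1-lipschitz_on UNIV p"
  obtains r where "r > 0"
    "\<And>x y. x \<in> {a..b} \<Longrightarrow> \<bar>y - x\<bar> < r \<Longrightarrow>
       ennreal \<bar>u (p y) - u (p x)\<bar> \<le> ennreal \<bar>y - x\<bar> * (g (p x) + g (p y))"
proof -
  define C where "C = {p -` U | U. open U \<and>
    (\<forall>x\<in>U. \<forall>y\<in>U. ennreal \<bar>u x - u y\<bar> \<le> ennreal (dist x y) * (g x + g y))}"
  have cont: "continuous_on UNIV p"
    using p by (rule lipschitz_on_continuous_on)
  have "{a..b} \<subseteq> \<Union>C"
  proof
    fix s
    obtain U where "open U" "p s \<in> U"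
        "\<forall>x\<in>U. \<forall>y\<in>U. ennreal \<bar>u x - u y\<bar> \<le> ennreal (dist x y) * (g x + g y)"
      using H unfolding everywhere_local_Hajlasz_def by meson
    then show "s \<in> \<Union>C" unfolding C_def by blast
  qed
  moreover have "open G" if "G \<in> C" for G
    using that cont by (auto simp: C_def intro: open_vimage)
  ultimately obtain r where r: "r > 0" "\<forall>x\<in>{a..b}. \<exists>G\<in>C. ball x r \<subseteq> G"
    using Heine_Borel_lemma[OF compact_Icc[of a b]] by metis
  show thesis
  proof (rule that[OF r(1)])
    fix x y :: real assume x: "x \<in> {a..b}" and y: "\<bar>y - x\<bar> < r"
    obtain U where U: "ball x r \<subseteq> p -` U"
        "\<forall>x\<in>U. \<forall>y\<in>U. ennreal \<bar>u x - u y\<bar> \<le> ennreal (dist x y) * (g x + g y)"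
      using r(2) x unfolding C_def by blast
    have "x \<in> ball x r" "y \<in> ball x r"
      using r(1) y by (auto simp: dist_real_def)
    then have "p x \<in> U" "p y \<in> U" using U(1) by blast+
    then have "ennreal \<bar>u (p y) - u (p x)\<bar> \<le> ennreal (dist (p y) (p x)) * (g (p y) + g (p x))"
      using U(2) by blast
    also have "\<dots> \<le> ennreal \<bar>y - x\<bar> * (g (p x) + g (p y))"
      using lipschitz_onD[OF p, of y x]
      by (intro mult_mono) (auto simp: dist_real_def add.commute intro!: ennreal_leI)
    finally show "ennreal \<bar>u (p y) - u (p x)\<bar> \<le> ennreal \<bar>y - x\<bar> * (g (p x) + g (p y))" .
  qed
qed

section \<open>Telescoping and averaging over translated grids\<close>

lemma ennreal_abs_diff_telescope:
  fixes f :: "nat \<Rightarrow> real"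
  shows "ennreal \<bar>f n - f 0\<bar> \<le> (\<Sum>i<n. ennreal \<bar>f (Suc i) - f i\<bar>)"
proof -
  have "\<bar>f n - f 0\<bar> \<le> (\<Sum>i<n. \<bar>f (Suc i) - f i\<bar>)"
  proof (induction n)
    case (Suc n)
    then show ?case using abs_triangle_ineq[of "f (Suc n) - f n" "f n - f 0"] by simp
  qed simp
  then show ?thesis by (simp add: sum_ennreal ennreal_leI)
qed

lemma nn_integral_shift_interval:
  fixes h :: "real \<Rightarrow> ennreal"
  assumes [measurable]: "h \<in> borel_measurable borel"
  shows "(\<integral>\<^sup>+t\<in>{0..<d}. h (c + t) \<partial>lborel) = (\<integral>\<^sup>+s\<in>{c..<c + d}. h s \<partial>lborel)"
  using nn_integral_real_affine[of "\<lambda>s. h s * indicator {c..<c + d} s" 1 c]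
  by (simp add: indicator_def)

lemma nn_integral_equal_pieces:
  fixes h :: "real \<Rightarrow> ennreal"
  assumes [measurable]: "h \<in> borel_measurable borel" and d: "d \<ge> 0"
  shows "(\<Sum>i<n. \<integral>\<^sup>+s\<in>{a + real i * d..<a + real i * d + d}. h s \<partial>lborel)
    = (\<integral>\<^sup>+s\<in>{a..<a + real n * d}. h s \<partial>lborel)"
proof (induction n)
  case (Suc n)
  have "{a..<a + real (Suc n) * d} = {a..<a + real n * d} \<union> {a + real n * d..<a + real n * d + d}"
    using d by (subst ivl_disj_un_two(3)) (auto simp: algebra_simps)
  then show ?case
    using Suc by (simp add: nn_integral_disjoint_pair)
qed simp

text \<open>The bound holds with \<open>e = 0\<close> on average over \<open>t\<close>.\<close>

lemma exists_good_offset: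
  fixes h :: "real \<Rightarrow> ennreal"
  assumes h[measurable]: "h \<in> borel_measurable borel" and ab: "a < b" and n: "n > 0" and e: "e > 0"
    and fin: "(\<integral>\<^sup>+s\<in>{a..b}. h s \<partial>lborel) < \<infinity>"
    and d: "d = (b - a) / real n"
  obtains t where "0 \<le> t" "t < d"
    "ennreal d * (\<Sum>i<n. h (a + real i * d + t)) \<le> (\<integral>\<^sup>+s\<in>{a..b}. h s \<partial>lborel) + ennreal e"
proof (rule ccontr)
  let ?I = "\<integral>\<^sup>+s\<in>{a..b}. h s \<partial>lborel"
  assume none: "\<not> thesis"
  note witness = that
  have big: "?I + ennreal e \<le> ennreal d * (\<Sum>i<n. h (a + real i * d + t))"
    if t: "0 \<le> t" "t < d" for t
  proof (rule ccontr)
    assume "\<not> ?I + ennreal e \<le> ennreal d * (\<Sum>i<n. h (a + real i * d + t))"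
    then show False using none witness[OF t] by (simp add: not_le less_imp_le)
  qed
  have dpos: "d > 0" using ab n d by simp
  \<comment> \<open>If every offset failed, the failure could be integrated over \<open>t\<close> in
    \<open>{0..<d}\<close>. The translates of the \<open>n\<close> grid points sweep out
    \<open>{a..<b}\<close> exactly once, so this would give \<open>?I + ennreal e \<le> ?I\<close>
    with \<open>?I\<close> finite.\<close>
  have "(?I + ennreal e) * ennreal d = (\<integral>\<^sup>+t\<in>{0..<d}. (?I + ennreal e) \<partial>lborel)"
    using dpos by (subst nn_integral_cmult_indicator) auto
  also have "\<dots> \<le> (\<integral>\<^sup>+t. ennreal d * (\<Sum>i<n. h (a + real i * d + t) * indicator {0..<d} t) \<partial>lborel)"
    using big by (intro nn_integral_mono) (simp add: indicator_def)
  also have "\<dots> = ennreal d * (\<Sum>i<n. \<integral>\<^sup>+t\<in>{0..<d}. h (a + real i * d + t) \<partial>lborel)"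
    by (subst nn_integral_cmult, measurable, subst nn_integral_sum, measurable)
  also have "\<dots> = ennreal d * (\<integral>\<^sup>+s\<in>{a..<a + real n * d}. h s \<partial>lborel)"
    using dpos by (simp add: nn_integral_shift_interval nn_integral_equal_pieces)
  also have "\<dots> \<le> ennreal d * ?I"
    using d n by (intro mult_left_mono nn_integral_mono) (auto split: split_indicator)
  finally have "ennreal d * (?I + ennreal e) \<le> ennreal d * ?I"
    by (simp add: mult.commute)
  then have "?I + ennreal e \<le> ?I"
    using dpos by (simp add: ennreal_mult_le_mult_iff)
  then show False
    using fin e by (cases ?I) (auto simp flip: ennreal_plus simp: top_unique)
qed

text \<open>The local inequality is summed over \<open>a\<close>, a translated grid, and
  \<open>b\<close>. Each grid point belongs to two consecutive steps, whence the factor 2; the two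
  end points contribute at most \<open>d * (g (p a) + g (p b))\<close>, which tends to 0 with the
  mesh because both values are finite.\<close>

lemma Hajlasz_along_path:
  fixes p :: "real \<Rightarrow> 'a::metric_space"
  assumes g[measurable]: "g \<in> borel_measurable borel" and H: "everywhere_local_Hajlasz g u"
    and p: "1-lipschitz_on UNIV p" and ab: "a < b" and fin: "g (p a) < \<infinity>" "g (p b) < \<infinity>"
  shows "ennreal \<bar>u (p b) - u (p a)\<bar> \<le> 2 * (\<integral>\<^sup>+s\<in>{a..b}. g (p s) \<partial>lborel)"
proof (rule ennreal_le_epsilon)
  let ?I = "\<integral>\<^sup>+s\<in>{a..b}. g (p s) \<partial>lborel"
  fix e :: real assume I: "2 * ?I < top" and e: "e > 0"
  have [measurable]: "p \<in> borel_measurable borel"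
    using p by (intro borel_measurable_continuous_onI lipschitz_on_continuous_on)
  have Ifin: "?I < \<infinity>"
    using I by (auto simp: ennreal_mult_less_top)
  obtain r where r: "r > 0"
    "\<And>x y. x \<in> {a..b} \<Longrightarrow> \<bar>y - x\<bar> < r \<Longrightarrow>
       ennreal \<bar>u (p y) - u (p x)\<bar> \<le> ennreal \<bar>y - x\<bar> * (g (p x) + g (p y))"
    using everywhere_local_Hajlasz_uniform[OF H p] by metis
  obtain A where A: "A \<ge> 0" "g (p a) + g (p b) = ennreal A"
    using fin by (cases "g (p a) + g (p b)") auto
  \<comment> \<open>The second bound keeps the end point contribution \<open>d * A\<close> below
    \<open>e / 2\<close>; adding 1 to \<open>A\<close> avoids division by zero.\<close>
  define r' where "r' = min r (e / (2 * (A + 1)))"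
  have r': "r' > 0" using r(1) e A by (auto simp: r'_def)
  obtain n where n: "n > 0" "(b - a) / r' < real n"
    using reals_Archimedean2[of "(b - a) / r'"] r' ab
    by (metis divide_pos_pos diff_gt_0_iff_gt gr0I less_asym of_nat_0)
  define d where "d = (b - a) / real n"
  have d: "d > 0" "d < r" "d * A \<le> e / 2"
  proof -
    show "d > 0" using ab n by (simp add: d_def)
    have dr: "d < r'" using n r' by (simp add: d_def field_simps)
    then show "d < r" by (simp add: r'_def)
    have "d * A \<le> e / (2 * (A + 1)) * (A + 1)"
      using dr A d_def \<open>d > 0\<close> by (intro mult_mono) (auto simp: r'_def)
    also have "\<dots> = e / 2" using A by (simp add: field_simps)
    finally show "d * A \<le> e / 2" .
  qed
  \<comment> \<open>The grid sum occurs twice below, so its error \<open>e / 4\<close> costs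
    \<open>e / 2\<close> in total.\<close>
  obtain t where t: "0 \<le> t" "t < d"
    "ennreal d * (\<Sum>i<n. g (p (a + real i * d + t))) \<le> ?I + ennreal (e / 4)"
    using exists_good_offset[where h="\<lambda>s. g (p s)" and e="e/4", OF _ ab n(1) _ _ d_def] Ifin e
    by auto
  \<comment> \<open>Indices 1 to \<open>n\<close> run through the translated grid, shifted by one to
    make room for \<open>a\<close>. The first gap is \<open>t\<close>, the last
    \<open>d - t\<close>, the others \<open>d\<close>.\<close>
  define q where "q i = (if i = 0 then a else if i = Suc n then b else a + (real i - 1) * d + t)" for i
  have nd: "a + real n * d = b" using n by (simp add: d_def)
  have gap: "0 \<le> q (Suc i) - q i" "q (Suc i) - q i \<le> d" if "i < Suc n" for i
    using that t nd n(1) by (auto simp: q_def algebra_simps)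
  have qin: "q i \<in> {a..b}" if "i < Suc n" for i
  proof -
    have "(real i - 1) * d + d \<le> real n * d" if "i \<noteq> 0"
      using that \<open>i < Suc n\<close> d(1) by (auto simp flip: distrib_right simp: algebra_simps intro!: mult_right_mono)
    moreover have "0 \<le> (real i - 1) * d" if "i \<noteq> 0"
      using that d(1) by (auto intro!: mult_nonneg_nonneg)
    ultimately show ?thesis using t nd that ab by (auto simp: q_def)
  qed
  let ?h = "\<lambda>i. g (p (q i))"
  let ?S = "\<Sum>i<n. g (p (a + real i * d + t))"
  have "ennreal \<bar>u (p b) - u (p a)\<bar> = ennreal \<bar>u (p (q (Suc n))) - u (p (q 0))\<bar>"
    by (simp add: q_def)
  also have "\<dots> \<le> (\<Sum>i<Suc n. ennreal \<bar>u (p (q (Suc i))) - u (p (q i))\<bar>)"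
    by (rule ennreal_abs_diff_telescope[of "\<lambda>i. u (p (q i))" "Suc n"])
  also have "\<dots> \<le> (\<Sum>i<Suc n. ennreal d * (?h i + ?h (Suc i)))"
  proof (rule sum_mono)
    fix i assume "i \<in> {..<Suc n}"
    then have i: "i < Suc n" by simp
    have "ennreal \<bar>u (p (q (Suc i))) - u (p (q i))\<bar> \<le> ennreal \<bar>q (Suc i) - q i\<bar> * (?h i + ?h (Suc i))"
      using gap[OF i] d(2) by (intro r(2) qin i) auto
    also have "\<dots> \<le> ennreal d * (?h i + ?h (Suc i))"
      using gap[OF i] by (intro mult_right_mono ennreal_leI) auto
    finally show "ennreal \<bar>u (p (q (Suc i))) - u (p (q i))\<bar> \<le> ennreal d * (?h i + ?h (Suc i))" .
  qed
  also have "\<dots> = ennreal d * ((\<Sum>i<Suc n. ?h i) + (\<Sum>i<Suc n. ?h (Suc i)))"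
    by (simp only: sum.distrib sum_distrib_left[symmetric])
  also have "(\<Sum>i<Suc n. ?h i) = g (p a) + ?S"
    by (subst sum.lessThan_Suc_shift) (simp add: q_def)
  also have "(\<Sum>i<Suc n. ?h (Suc i)) = ?S + g (p b)"
    by (simp add: q_def)
  also have "ennreal d * (g (p a) + ?S + (?S + g (p b))) =
      ennreal d * (g (p a) + g (p b)) + (ennreal d * ?S + ennreal d * ?S)"
    by (simp add: algebra_simps)
  also have "\<dots> \<le> ennreal (e / 2) + ((?I + ennreal (e / 4)) + (?I + ennreal (e / 4)))"
    using A d by (intro add_mono t) (auto simp flip: ennreal_mult intro!: ennreal_leI)
  also have "\<dots> = 2 * ?I + (ennreal (e / 2) + (ennreal (e / 4) + ennreal (e / 4)))"
    by (simp only: mult_2 ac_simps)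
  also have "ennreal (e / 2) + (ennreal (e / 4) + ennreal (e / 4)) = ennreal e"
    using e by (simp flip: ennreal_plus)
  finally show "ennreal \<bar>u (p b) - u (p a)\<bar> \<le> 2 * ?I + ennreal e" .
qed

text \<open>Running \<open>p\<close> backwards to the common starting point and then following
  \<open>p'\<close> is again a 1-Lipschitz path. Only its end points must have finite
  \<open>g\<close>, so \<open>g\<close> may be \<infinity> at the point where the paths
  meet.\<close>

lemma Hajlasz_two_paths:
  fixes p p' :: "real \<Rightarrow> 'a::metric_space"
  assumes g[measurable]: "g \<in> borel_measurable borel" and H: "everywhere_local_Hajlasz g u"
    and p: "1-lipschitz_on UNIV p" and p': "1-lipschitz_on UNIV p'" and "p 0 = p' 0"
    and t: "t > 0" "t' > 0" and fin: "g (p t) < \<infinity>" "g (p' t') < \<infinity>"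
  shows "ennreal \<bar>u (p t) - u (p' t')\<bar> \<le>
    2 * (\<integral>\<^sup>+s\<in>{0..t}. g (p s) \<partial>lborel) + 2 * (\<integral>\<^sup>+s\<in>{0..t'}. g (p' s) \<partial>lborel)"
proof -
  have [measurable]: "p \<in> borel_measurable borel" "p' \<in> borel_measurable borel"
    using p p' by (auto intro!: borel_measurable_continuous_onI lipschitz_on_continuous_on)
  define q where "q s = (if s < 0 then p (- s) else p' s)" for s
  \<comment> \<open>The triangle inequality through the common point \<open>p 0\<close> handles
    parameters on opposite sides of 0.\<close>
  have mixed: "dist (p (- s)) (p' s') \<le> s' - s" if "s \<le> 0" "0 \<le> s'" for s s'
    using that lipschitz_onD[OF p, of "-s" 0] lipschitz_onD[OF p', of 0 s']
      dist_triangle[of "p (- s)" "p' s'" "p 0"] \<open>p 0 = p' 0\<close> by (auto simp: dist_real_def)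
  have q: "1-lipschitz_on UNIV q"
  proof (rule lipschitz_onI)
    fix s s' :: real
    show "dist (q s) (q s') \<le> 1 * dist s s'"
      using mixed[of s s'] mixed[of s' s] lipschitz_onD[OF p, of "-s" "-s'"] lipschitz_onD[OF p', of s s']
      by (auto simp: q_def dist_real_def dist_commute)
  qed simp
  have "q (- t) = p t" "q t' = p' t'" using t by (auto simp: q_def)
  then have "ennreal \<bar>u (p t) - u (p' t')\<bar> \<le> 2 * (\<integral>\<^sup>+s\<in>{-t..t'}. g (q s) \<partial>lborel)"
    using Hajlasz_along_path[OF g H q, of "-t" t'] fin t by (simp add: abs_minus_commute)
  also have "(\<integral>\<^sup>+s\<in>{-t..t'}. g (q s) \<partial>lborel) \<le>
      (\<integral>\<^sup>+s. g (p (- s)) * indicator {0..t} (- s) + g (p' s) * indicator {0..t'} s \<partial>lborel)"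
    by (intro nn_integral_mono) (auto simp: q_def split: split_indicator)
  also have "\<dots> = (\<integral>\<^sup>+s. g (p (- s)) * indicator {0..t} (- s) \<partial>lborel) + (\<integral>\<^sup>+s\<in>{0..t'}. g (p' s) \<partial>lborel)"
    by (rule nn_integral_add) measurable
  also have "(\<integral>\<^sup>+s. g (p (- s)) * indicator {0..t} (- s) \<partial>lborel) = (\<integral>\<^sup>+s\<in>{0..t}. g (p s) \<partial>lborel)"
    using nn_integral_real_affine[of "\<lambda>s. g (p s) * indicator {0..t} s" "-1" 0] by simp
  finally show ?thesis by (simp add: distrib_left mult_left_mono)
qed

text \<open>At points where \<open>g\<close> is infinite, the value of the representative is squeezed between
  the bounds \<open>u (p t) \<plusminus> 2 \<integral> g \<circ> p\<close> coming from all paths \<open>p\<close> that start there; by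
  Hajlasz_two_paths every lower bound is below every upper bound.\<close>

lemma Hajlasz_value_at_start:
  fixes g :: "'a::metric_space \<Rightarrow> ennreal"
  assumes g[measurable]: "g \<in> borel_measurable borel" and H: "everywhere_local_Hajlasz g u"
  shows "\<exists>c. (g x < \<infinity> \<longrightarrow> c = u x) \<and>
    (\<forall>(p :: real \<Rightarrow> 'a) t. 1-lipschitz_on UNIV p \<and> p 0 = x \<and> t > 0 \<and> g (p t) < \<infinity> \<longrightarrow>
       ennreal \<bar>c - u (p t)\<bar> \<le> 2 * (\<integral>\<^sup>+s\<in>{0..t}. g (p s) \<partial>lborel))"
proof (cases "g x < \<infinity>")
  case True
  have "ennreal \<bar>u x - u (p t)\<bar> \<le> 2 * (\<integral>\<^sup>+s\<in>{0..t}. g (p s) \<partial>lborel)"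
    if "1-lipschitz_on UNIV p" "p 0 = x" "t > 0" "g (p t) < \<infinity>" for p :: "real \<Rightarrow> 'a" and t
    using that Hajlasz_along_path[OF g H, of p 0 t] True by (simp add: abs_minus_commute)
  then show ?thesis by blast
next
  case False
  define I where "I p t = (\<integral>\<^sup>+s\<in>{0..t}. g (p s) \<partial>lborel)" for p :: "real \<Rightarrow> 'a" and t
  \<comment> \<open>Paths of infinite integral are left out: they impose no condition, and
    \<open>enn2real\<close> would turn their integral into 0.\<close>
  define good where "good p t \<longleftrightarrow> 1-lipschitz_on UNIV p \<and> p 0 = x \<and> t > 0 \<and> g (p t) < \<infinity> \<and> I p t < \<infinity>"
    for p :: "real \<Rightarrow> 'a" and t
  define L where "L = {u (p t) - 2 * enn2real (I p t) | p t. good p t}"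
  \<comment> \<open>If no path is \<open>good\<close>, then \<open>L\<close> is empty and the value
    of \<open>c\<close> is immaterial. Otherwise any good path bounds \<open>L\<close> from above,
    by \<open>sep\<close>.\<close>
  define c where "c = Sup L"
  have sep: "u (p t) - 2 * enn2real (I p t) \<le> u (p' t') + 2 * enn2real (I p' t')"
    if good: "good p t" "good p' t'" for p t p' t'
  proof -
    obtain i i' where i: "I p t = ennreal i" "i \<ge> 0" "I p' t' = ennreal i'" "i' \<ge> 0"
      using good by (cases "I p t"; cases "I p' t'") (auto simp: good_def)
    have "ennreal \<bar>u (p t) - u (p' t')\<bar> \<le> 2 * I p t + 2 * I p' t'"
      using good Hajlasz_two_paths[OF g H, of p p' t t'] by (auto simp: good_def I_def)
    also have "\<dots> = ennreal (2 * i + 2 * i')"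
      using i by (simp add: ennreal_mult)
    finally have "\<bar>u (p t) - u (p' t')\<bar> \<le> 2 * i + 2 * i'"
      by (subst (asm) ennreal_le_iff) (use i in auto)
    then show ?thesis using i by simp
  qed
  have "ennreal \<bar>c - u (p t)\<bar> \<le> 2 * I p t"
    if p: "1-lipschitz_on UNIV p" "p 0 = x" "t > 0" "g (p t) < \<infinity>" for p t
  proof (cases "I p t < \<infinity>")
    case True
    then have gd: "good p t" using p by (simp add: good_def)
    then have inL: "u (p t) - 2 * enn2real (I p t) \<in> L" by (auto simp: L_def)
    have ub: "y \<le> u (p t) + 2 * enn2real (I p t)" if "y \<in> L" for y
      using that sep gd by (auto simp: L_def)
    have "u (p t) - 2 * enn2real (I p t) \<le> c"
      unfolding c_def using inL ub by (intro cSup_upper bdd_aboveI) auto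
    moreover have "c \<le> u (p t) + 2 * enn2real (I p t)"
      unfolding c_def using inL ub by (intro cSup_least) auto
    ultimately have "\<bar>c - u (p t)\<bar> \<le> 2 * enn2real (I p t)" by linarith
    then have "ennreal \<bar>c - u (p t)\<bar> \<le> ennreal (2 * enn2real (I p t))" by (rule ennreal_leI)
    also have "\<dots> = 2 * I p t" using True by (simp add: ennreal_mult)
    finally show ?thesis .
  next
    case False
    then have "I p t = top" by (simp add: not_less top_unique)
    then show ?thesis by (simp add: ennreal_mult_eq_top_iff)
  qed
  then show ?thesis using False unfolding I_def by blast
qed

text \<open>Supplies an interior parameter with finite \<open>g\<close>, through which the new
  values at the two ends of a path are compared.\<close>

lemma finite_point_of_finite_integral:
  fixes h :: "real \<Rightarrow> ennreal"
  assumes "L > 0" "(\<integral>\<^sup>+s\<in>{0..L}. h s \<partial>lborel) < \<infinity>"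
  obtains t where "0 < t" "t < L" "h t < \<infinity>"
proof (rule ccontr)
  assume none: "\<not> thesis"
  note witness = that
  have inf: "h t = top" if t: "0 < t" "t < L" for t
    using none witness[OF t] by (metis infinity_ennreal_def top.not_eq_extremum)
  have "top = (\<integral>\<^sup>+s. top * indicator {0<..<L} s \<partial>lborel)"
    using assms(1) by (subst nn_integral_cmult_indicator) (auto simp: ennreal_top_mult)
  also have "\<dots> \<le> (\<integral>\<^sup>+s\<in>{0..L}. h s \<partial>lborel)"
    using inf by (intro nn_integral_mono) (auto split: split_indicator)
  finally show False using assms(2) by (simp add: top_unique)
qed

text \<open>Both end values are compared with \<open>u (p t)\<close> at an interior point where
  \<open>g\<close> is finite: from \<open>p 0\<close> along \<open>p\<close>, and from
  \<open>p L\<close> along the reversed path. Each comparison costs at most twice the full integral,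
  giving the factor 4.\<close>

lemma Hajlasz_representative_of_function:
  fixes g :: "'a::metric_space \<Rightarrow> ennreal"
  assumes g[measurable]: "g \<in> borel_measurable borel" and H: "everywhere_local_Hajlasz g u"
  shows "\<exists>v. (\<forall>x. g x < \<infinity> \<longrightarrow> v x = u x) \<and>
    (\<forall>(p :: real \<Rightarrow> 'a) L. 1-lipschitz_on UNIV p \<and> L > 0 \<longrightarrow>
       ennreal \<bar>v (p 0) - v (p L)\<bar> \<le> 4 * (\<integral>\<^sup>+s\<in>{0..L}. g (p s) \<partial>lborel))"
proof -
  obtain v where v: "\<And>x. g x < \<infinity> \<Longrightarrow> v x = u x"
    "\<And>(p :: real \<Rightarrow> 'a) t. 1-lipschitz_on UNIV p \<Longrightarrow> t > 0 \<Longrightarrow> g (p t) < \<infinity> \<Longrightarrow>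
       ennreal \<bar>v (p 0) - u (p t)\<bar> \<le> 2 * (\<integral>\<^sup>+s\<in>{0..t}. g (p s) \<partial>lborel)"
    using Hajlasz_value_at_start[OF g H] by metis
  show ?thesis
  proof (intro exI[of _ v] conjI allI impI)
    fix p :: "real \<Rightarrow> 'a" and L :: real
    assume "1-lipschitz_on UNIV p \<and> L > 0"
    then have p: "1-lipschitz_on UNIV p" and L: "L > 0" by auto
    let ?I = "\<integral>\<^sup>+s\<in>{0..L}. g (p s) \<partial>lborel"
    have [measurable]: "p \<in> borel_measurable borel"
      using p by (intro borel_measurable_continuous_onI lipschitz_on_continuous_on)
    show "ennreal \<bar>v (p 0) - v (p L)\<bar> \<le> 4 * ?I"
    proof (cases "?I < \<infinity>")
      case True
      then obtain t where t: "0 < t" "t < L" "g (p t) < \<infinity>"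
        using finite_point_of_finite_integral[OF L] by metis
      let ?q = "\<lambda>s. p (L - s)"
      have "1-lipschitz_on UNIV ?q"
      proof (rule lipschitz_onI)
        show "dist (?q s) (?q s') \<le> 1 * dist s s'" for s s'
          using lipschitz_onD[OF p, of "L - s" "L - s'"] by (simp add: dist_real_def abs_minus_commute)
      qed simp
      then have "ennreal \<bar>v (p L) - u (p t)\<bar> \<le> 2 * (\<integral>\<^sup>+s\<in>{0..L - t}. g (?q s) \<partial>lborel)"
        using v(2)[of ?q "L - t"] t by simp
      also have "(\<integral>\<^sup>+s\<in>{0..L - t}. g (?q s) \<partial>lborel) \<le> (\<integral>\<^sup>+s. g (?q s) * indicator {0..L} (L - s) \<partial>lborel)"
        using t by (intro nn_integral_mono) (auto split: split_indicator)
      also have "\<dots> = ?I"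
        using nn_integral_real_affine[of "\<lambda>s. g (p s) * indicator {0..L} s" "-1" L] by simp
      finally have 1: "ennreal \<bar>v (p L) - u (p t)\<bar> \<le> 2 * ?I" by (simp add: mult_left_mono)
      have "ennreal \<bar>v (p 0) - u (p t)\<bar> \<le> 2 * (\<integral>\<^sup>+s\<in>{0..t}. g (p s) \<partial>lborel)"
        using v(2)[OF p t(1,3)] .
      also have "\<dots> \<le> 2 * ?I"
        using t by (intro mult_left_mono nn_integral_mono) (auto split: split_indicator)
      finally have 2: "ennreal \<bar>v (p 0) - u (p t)\<bar> \<le> 2 * ?I" .
      have "ennreal \<bar>v (p 0) - v (p L)\<bar> \<le> ennreal \<bar>v (p 0) - u (p t)\<bar> + ennreal \<bar>v (p L) - u (p t)\<bar>"
        by (auto simp flip: ennreal_plus intro!: ennreal_leI)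
      also have "\<dots> \<le> 2 * ?I + 2 * ?I" by (rule add_mono[OF 2 1])
      also have "\<dots> = 4 * ?I" by (simp flip: distrib_right)
      finally show ?thesis .
    next
      case False
      then have "?I = top" by (simp add: not_less top_unique)
      then show ?thesis by (simp add: ennreal_mult_eq_top_iff)
    qed
  qed (use v in auto)
qed

section \<open>Arc length\<close>

lemma sum_le_curve_length:
  assumes "t 0 = a" "t n = b" "mono_on {..n} t"
  shows "(\<Sum>i<n. ennreal (dist (\<gamma> (t i)) (\<gamma> (t (Suc i))))) \<le> curve_length \<gamma> a b"
  unfolding curve_length_def by (rule SUP_upper2[of "(t, n)"]) (use assms in auto)

lemma curve_length_least:
  assumes "\<And>t n. t 0 = a \<Longrightarrow> t n = b \<Longrightarrow> mono_on {..n} t \<Longrightarrow>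
    (\<Sum>i<n. ennreal (dist (\<gamma> (t i)) (\<gamma> (t (Suc i))))) \<le> M"
  shows "curve_length \<gamma> a b \<le> M"
  unfolding curve_length_def by (rule SUP_least) (use assms in auto)

lemma less_curve_lengthE:
  assumes "c < curve_length \<gamma> a b"
  obtains t n where "t 0 = a" "t n = b" "mono_on {..n} t"
    "c < (\<Sum>i<n. ennreal (dist (\<gamma> (t i)) (\<gamma> (t (Suc i)))))"
  using assms unfolding curve_length_def less_SUP_iff by auto

lemma dist_le_curve_length:
  assumes "a \<le> b"
  shows "ennreal (dist (\<gamma> a) (\<gamma> b)) \<le> curve_length \<gamma> a b"
  using sum_le_curve_length[of "\<lambda>i. if i = 0 then a else b" a 1 b \<gamma>] assms
  by (auto simp: mono_on_def)

lemma curve_length_refl [simp]: "curve_length \<gamma> a a = 0"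
proof -
  have "(\<Sum>i<n. ennreal (dist (\<gamma> (t i)) (\<gamma> (t (Suc i))))) \<le> 0"
    if t: "t 0 = a" "t n = a" "mono_on {..n} t" for t n
  proof -
    have "t i = a" if "i \<le> n" for i
      using mono_onD[OF t(3), of 0 i] mono_onD[OF t(3), of i n] that t by auto
    then show ?thesis by (simp add: Suc_leI)
  qed
  then show ?thesis
    using curve_length_least[of a a \<gamma> 0] by simp
qed

lemma curve_length_superadditive:
  assumes "a \<le> c" "c \<le> b"
  shows "curve_length \<gamma> a c + curve_length \<gamma> c b \<le> curve_length \<gamma> a b"
proof -
  have concat: "(\<Sum>i<n. ennreal (dist (\<gamma> (t i)) (\<gamma> (t (Suc i))))) +
      (\<Sum>i<m. ennreal (dist (\<gamma> (t' i)) (\<gamma> (t' (Suc i))))) \<le> curve_length \<gamma> a b"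
    if t: "t 0 = a" "t n = c" "mono_on {..n} t" and t': "t' 0 = c" "t' m = b" "mono_on {..m} t'"
    for t n t' m
  proof -
    \<comment> \<open>The two partitions are glued at index \<open>n\<close>, where both take the
      value \<open>c\<close>.\<close>
    define w where "w i = (if i \<le> n then t i else t' (i - n))" for i
    have w: "w i = t i" if "i \<le> n" for i using that by (simp add: w_def)
    have w': "w (n + i) = t' i" for i using t t' by (cases i) (auto simp: w_def)
    have split: "(\<Sum>i<n + k. f i) = (\<Sum>i<n. f i) + (\<Sum>i<k. f (n + i))" for f :: "nat \<Rightarrow> ennreal" and k
      by (induction k) (auto simp: add.assoc)
    have "mono_on {..n + m} w"
    proof (rule mono_onI)
      fix i j assume ij: "i \<in> {..n + m}" "j \<in> {..n + m}" "i \<le> j"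
      consider "j \<le> n" | "i \<le> n" "n < j" | "n < i" using ij by linarith
      then show "w i \<le> w j"
      proof cases
        case 1
        then show ?thesis using mono_onD[OF t(3), of i j] ij by (simp add: w)
      next
        case 2
        then have "t i \<le> c" using mono_onD[OF t(3), of i n] t by simp
        moreover have "c \<le> t' (j - n)" using mono_onD[OF t'(3), of 0 "j - n"] t' ij by simp
        ultimately show ?thesis using 2 by (simp add: w_def)
      next
        case 3
        then show ?thesis using mono_onD[OF t'(3), of "i - n" "j - n"] ij by (simp add: w_def)
      qed
    qed
    then have "(\<Sum>i<n + m. ennreal (dist (\<gamma> (w i)) (\<gamma> (w (Suc i))))) \<le> curve_length \<gamma> a b"
      using t t' w' w by (intro sum_le_curve_length) auto
    then show ?thesis
      using w' w'[of "Suc _"] by (simp add: split w)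
  qed
  let ?P = "\<lambda>a b. {(t :: nat \<Rightarrow> real, n). t 0 = a \<and> t n = b \<and> mono_on {..n} t}"
  \<comment> \<open>Adding a constant commutes with a supremum in \<open>ennreal\<close> only over a
    nonempty index set.\<close>
  have ne: "?P x y \<noteq> {}" if "x \<le> y" for x y
    using that by (auto intro!: exI[of _ "\<lambda>i. if i = 0 then x else y"] exI[of _ 1] simp: mono_on_def)
  have "curve_length \<gamma> a c + (\<Sum>i<m. ennreal (dist (\<gamma> (t' i)) (\<gamma> (t' (Suc i))))) \<le> curve_length \<gamma> a b"
    if "t' 0 = c" "t' m = b" "mono_on {..m} t'" for t' m
    unfolding curve_length_def[of \<gamma> a c] using ne[OF assms(1)] that concat
    by (subst ennreal_SUP_add_left[symmetric]) (auto intro!: SUP_least)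
  then show ?thesis
    unfolding curve_length_def[of \<gamma> c b] using ne[OF assms(2)]
    by (subst ennreal_SUP_add_right) (auto intro!: SUP_least)
qed

lemma curve_length_mono:
  assumes "a \<le> c" "c \<le> b"
  shows "curve_length \<gamma> a c \<le> curve_length \<gamma> a b" "curve_length \<gamma> c b \<le> curve_length \<gamma> a b"
  using curve_length_superadditive[OF assms, of \<gamma>] by (auto intro: order_trans[rotated])

text \<open>Used with \<open>min c\<close> and \<open>max c\<close>, which clamp a partition to one
  side of \<open>c\<close>.\<close>

lemma sum_mono_image_le_curve_length:
  assumes "mono \<phi>" "t 0 = a" "t n = b" "mono_on {..n} t"
  shows "(\<Sum>i<n. ennreal (dist (\<gamma> (\<phi> (t i))) (\<gamma> (\<phi> (t (Suc i)))))) \<le> curve_length \<gamma> (\<phi> a) (\<phi> b)"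
  by (rule sum_le_curve_length) (use assms in \<open>auto simp: mono_on_def dest: monoD\<close>)

lemma mono_min_max: "mono (min (c::real))" "mono (max (c::real))"
  by (auto simp: mono_def)

text \<open>Clamping a partition at \<open>c\<close> from either side yields partitions of
  \<open>[a, c]\<close> and \<open>[c, b]\<close>. The triangle inequality matters only for the step
  that straddles \<open>c\<close>; elsewhere one of the two new terms vanishes.\<close>

lemma curve_length_additive:
  assumes "a \<le> c" "c \<le> b"
  shows "curve_length \<gamma> a b = curve_length \<gamma> a c + curve_length \<gamma> c b"
proof (rule antisym[OF curve_length_least curve_length_superadditive[OF assms]])
  fix t :: "nat \<Rightarrow> real" and n assume t: "t 0 = a" "t n = b" "mono_on {..n} t"
  have "dist (\<gamma> (t i)) (\<gamma> (t (Suc i))) \<le>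
      dist (\<gamma> (min c (t i))) (\<gamma> (min c (t (Suc i)))) + dist (\<gamma> (max c (t i))) (\<gamma> (max c (t (Suc i))))"
    if "i < n" for i
    using mono_onD[OF t(3), of i "Suc i"] that dist_triangle[of "\<gamma> (t i)" "\<gamma> (t (Suc i))" "\<gamma> c"]
    by (auto simp: min_def max_def)
  then have "(\<Sum>i<n. ennreal (dist (\<gamma> (t i)) (\<gamma> (t (Suc i))))) \<le>
      (\<Sum>i<n. ennreal (dist (\<gamma> (min c (t i))) (\<gamma> (min c (t (Suc i)))))) +
      (\<Sum>i<n. ennreal (dist (\<gamma> (max c (t i))) (\<gamma> (max c (t (Suc i))))))"
    unfolding sum.distrib[symmetric]
    by (intro sum_mono) (auto simp flip: ennreal_plus intro!: ennreal_leI)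
  also have "\<dots> \<le> curve_length \<gamma> (min c a) (min c b) + curve_length \<gamma> (max c a) (max c b)"
    using t by (intro add_mono sum_mono_image_le_curve_length mono_min_max)
  finally show "(\<Sum>i<n. ennreal (dist (\<gamma> (t i)) (\<gamma> (t (Suc i))))) \<le> curve_length \<gamma> a c + curve_length \<gamma> c b"
    using assms by (simp add: min_def max_def split: if_splits)
qed

text \<open>Truncating a nearly optimal partition of \<open>[a, s]\<close> at \<open>t\<close> changes the sum continuously.\<close>

lemma curve_length_lower_semicontinuous_right_end:
  assumes cont: "continuous_on {a..b} \<gamma>" and s: "s \<in> {a..b}" and c: "c < curve_length \<gamma> a s"
  shows "\<forall>\<^sub>F t in at s within {a..b}. c < curve_length \<gamma> a t"
proof -
  obtain w n where w: "w 0 = a" "w n = s" "mono_on {..n} w"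
    "c < (\<Sum>i<n. ennreal (dist (\<gamma> (w i)) (\<gamma> (w (Suc i)))))"
    using less_curve_lengthE[OF c] by metis
  define F where "F t = (\<Sum>i<n. ennreal (dist (\<gamma> (min t (w i))) (\<gamma> (min t (w (Suc i))))))" for t
  have win: "a \<le> w i" "w i \<le> s" if "i \<le> n" for i
    using mono_onD[OF w(3), of 0 i] mono_onD[OF w(3), of i n] that w by auto
  have "continuous_on {a..b} (\<lambda>t. \<gamma> (min t (w i)))" if "i \<le> n" for i
    by (rule continuous_on_compose2[OF cont]) (use win[OF that] s in \<open>auto intro!: continuous_intros\<close>)
  then have "continuous_on {a..b} F"
    unfolding F_def by (intro continuous_intros continuous_on_ennreal) auto
  then have "(F \<longlongrightarrow> F s) (at s within {a..b})"
    using s by (simp add: continuous_on_def)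
  moreover have "F s = (\<Sum>i<n. ennreal (dist (\<gamma> (w i)) (\<gamma> (w (Suc i)))))"
    unfolding F_def using win by (intro sum.cong) (auto simp: min_absorb2)
  ultimately have "\<forall>\<^sub>F t in at s within {a..b}. c < F t"
    using w(4) by (auto dest: order_tendstoD)
  then show ?thesis
    unfolding eventually_at_filter
  proof (rule eventually_mono, intro impI)
    fix t assume t: "t \<noteq> s \<longrightarrow> t \<in> {a..b} \<longrightarrow> c < F t" "t \<noteq> s" "t \<in> {a..b}"
    have "F t \<le> curve_length \<gamma> (min t a) (min t s)"
      unfolding F_def using w by (intro sum_mono_image_le_curve_length mono_min_max)
    also have "\<dots> \<le> curve_length \<gamma> a t"
      using t s by (simp add: min_absorb2 curve_length_mono)
    finally show "c < curve_length \<gamma> a t" using t by (auto intro: less_le_trans)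
  qed
qed

text \<open>Mirror image of the preceding argument: the partition of \<open>[s, b]\<close> is
  clamped from below by \<open>max t\<close>.\<close>

lemma curve_length_lower_semicontinuous_left_end:
  assumes cont: "continuous_on {a..b} \<gamma>" and s: "s \<in> {a..b}" and c: "c < curve_length \<gamma> s b"
  shows "\<forall>\<^sub>F t in at s within {a..b}. c < curve_length \<gamma> t b"
proof -
  obtain w n where w: "w 0 = s" "w n = b" "mono_on {..n} w"
    "c < (\<Sum>i<n. ennreal (dist (\<gamma> (w i)) (\<gamma> (w (Suc i)))))"
    using less_curve_lengthE[OF c] by metis
  define F where "F t = (\<Sum>i<n. ennreal (dist (\<gamma> (max t (w i))) (\<gamma> (max t (w (Suc i))))))" for t
  have win: "s \<le> w i" "w i \<le> b" if "i \<le> n" for i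
    using mono_onD[OF w(3), of 0 i] mono_onD[OF w(3), of i n] that w by auto
  have "continuous_on {a..b} (\<lambda>t. \<gamma> (max t (w i)))" if "i \<le> n" for i
    by (rule continuous_on_compose2[OF cont]) (use win[OF that] s in \<open>auto intro!: continuous_intros\<close>)
  then have "continuous_on {a..b} F"
    unfolding F_def by (intro continuous_intros continuous_on_ennreal) auto
  then have "(F \<longlongrightarrow> F s) (at s within {a..b})"
    using s by (simp add: continuous_on_def)
  moreover have "F s = (\<Sum>i<n. ennreal (dist (\<gamma> (w i)) (\<gamma> (w (Suc i)))))"
    unfolding F_def using win by (intro sum.cong) (auto simp: max_absorb2)
  ultimately have "\<forall>\<^sub>F t in at s within {a..b}. c < F t"
    using w(4) by (auto dest: order_tendstoD)
  then show ?thesis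
    unfolding eventually_at_filter
  proof (rule eventually_mono, intro impI)
    fix t assume t: "t \<noteq> s \<longrightarrow> t \<in> {a..b} \<longrightarrow> c < F t" "t \<noteq> s" "t \<in> {a..b}"
    have "F t \<le> curve_length \<gamma> (max t s) (max t b)"
      unfolding F_def using w by (intro sum_mono_image_le_curve_length mono_min_max)
    also have "\<dots> \<le> curve_length \<gamma> t b"
      using t s by (simp add: max_absorb2 curve_length_mono)
    finally show "c < curve_length \<gamma> t b" using t by (auto intro: less_le_trans)
  qed
qed

text \<open>Lower semicontinuity is already known. Upper semicontinuity follows because the length
  of \<open>[a, t]\<close> is the finite total minus the length of \<open>[t, b]\<close>, and the
  latter is lower semicontinuous as well.\<close>

lemma continuous_on_curve_length:
  assumes cont: "continuous_on {a..b} \<gamma>" and fin: "curve_length \<gamma> a b < \<infinity>"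
  shows "continuous_on {a..b} (curve_length \<gamma> a)"
  unfolding continuous_on_def
proof (intro ballI order_tendstoI)
  fix s c assume s: "s \<in> {a..b}"
  show "\<forall>\<^sub>F t in at s within {a..b}. c < curve_length \<gamma> a t" if "c < curve_length \<gamma> a s"
    using curve_length_lower_semicontinuous_right_end[OF cont s that] .
  show "\<forall>\<^sub>F t in at s within {a..b}. curve_length \<gamma> a t < c" if "curve_length \<gamma> a s < c"
  proof -
    have add: "curve_length \<gamma> a b = curve_length \<gamma> a t + curve_length \<gamma> t b" if "t \<in> {a..b}" for t
      using that by (intro curve_length_additive) auto
    obtain x y where xy: "curve_length \<gamma> a s = ennreal x" "x \<ge> 0" "curve_length \<gamma> s b = ennreal y" "y \<ge> 0"
      using add[OF s] fin by (cases "curve_length \<gamma> a s"; cases "curve_length \<gamma> s b") auto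
    \<comment> \<open>The bound \<open>c\<close> may be \<infinity>; an intermediate finite value
      permits real subtraction.\<close>
    obtain c' where c': "ennreal x < c'" "c' < c"
      using dense[OF \<open>curve_length \<gamma> a s < c\<close>] xy by auto
    then obtain z where z: "c' = ennreal z" "z \<ge> 0" by (cases c') auto
    have "x < z" using c'(1) z xy by (simp add: ennreal_less_iff)
    have tot: "curve_length \<gamma> a t + curve_length \<gamma> t b = ennreal (x + y)" if "t \<in> {a..b}" for t
      using add[OF that] add[OF s] xy by simp
    have "\<forall>\<^sub>F t in at s within {a..b}. t \<in> {a..b} \<longrightarrow> curve_length \<gamma> a t \<le> ennreal z"
    \<comment> \<open>When the total length is at most \<open>z\<close> there is nothing to prove.
      Separating this case keeps \<open>x + y - z\<close> positive below, as \<open>ennreal\<close>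
      truncates negative numbers to 0.\<close>
    proof (cases "x + y \<le> z")
      case True
      have "curve_length \<gamma> a t \<le> ennreal z" if "t \<in> {a..b}" for t
      proof -
        have "curve_length \<gamma> a t \<le> ennreal (x + y)" unfolding tot[OF that, symmetric] by simp
        also have "\<dots> \<le> ennreal z" using True by (rule ennreal_leI)
        finally show ?thesis .
      qed
      then show ?thesis by simp
    next
      case False
      then have "ennreal (x + y - z) < curve_length \<gamma> s b"
        using xy \<open>x < z\<close> by (simp add: ennreal_less_iff)
      from curve_length_lower_semicontinuous_left_end[OF cont s this] show ?thesis
      proof (rule eventually_mono, intro impI)
        fix t assume t: "ennreal (x + y - z) < curve_length \<gamma> t b" "t \<in> {a..b}"
        obtain l r where lr: "curve_length \<gamma> a t = ennreal l" "l \<ge> 0" "curve_length \<gamma> t b = ennreal r" "r \<ge> 0"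
          using add[OF t(2)] fin by (cases "curve_length \<gamma> a t"; cases "curve_length \<gamma> t b") auto
        have "l + r = x + y"
          using tot[OF t(2)] lr xy by (simp flip: ennreal_plus)
        moreover have "x + y - z < r"
          using t(1) lr False by (simp add: ennreal_less_iff)
        ultimately show "curve_length \<gamma> a t \<le> ennreal z" using lr by (simp add: ennreal_leI)
      qed
    qed
    moreover have "\<forall>\<^sub>F t in at s within {a..b}. t \<in> {a..b}"
      by (simp add: eventually_at_filter)
    ultimately show ?thesis
      by eventually_elim (use c' z in \<open>auto intro: le_less_trans\<close>)
  qed
qed

text \<open>The intermediate value theorem for the length function gives a point for each
  \<open>s\<close>. Extending the parametrization by constants outside \<open>[0, L]\<close> puts it
  in the form required by the path estimates.\<close>

lemma arclength_param_lipschitz_extension: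
  fixes \<gamma> :: "real \<Rightarrow> 'a::metric_space"
  assumes rect: "rectifiable_curve \<gamma> a b" and L: "L = enn2real (curve_length \<gamma> a b)"
  obtains q where "1-lipschitz_on UNIV q" "q 0 = \<gamma> a" "q L = \<gamma> b"
    "\<forall>s\<in>{0..L}. arclength_param \<gamma> a b s = q s"
proof -
  let ?p = "arclength_param \<gamma> a b"
  have ab: "a \<le> b" and cont: "continuous_on {a..b} \<gamma>" and fin: "curve_length \<gamma> a b < \<infinity>"
    using rect by (auto simp: rectifiable_curve_def)
  have L': "ennreal L = curve_length \<gamma> a b" "L \<ge> 0" using fin L by auto
  \<comment> \<open>With \<open>s = s'\<close> this shows that the described point is unique; in
    general it is the 1-Lipschitz bound.\<close>
  have close: "dist (\<gamma> t) (\<gamma> t') \<le> s' - s"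
    if t: "t \<in> {a..b}" "t' \<in> {a..b}" "curve_length \<gamma> a t = ennreal s" "curve_length \<gamma> a t' = ennreal s'"
      "0 \<le> s" "0 \<le> s'" "t \<le> t'" for t t' s s'
  proof -
    have "ennreal (s + dist (\<gamma> t) (\<gamma> t')) \<le> curve_length \<gamma> a t + curve_length \<gamma> t t'"
      using t dist_le_curve_length[OF t(7), of \<gamma>] by (simp add: add_left_mono)
    also have "\<dots> \<le> ennreal s'"
      using curve_length_superadditive[of a t t' \<gamma>] t by simp
    finally have "s + dist (\<gamma> t) (\<gamma> t') \<le> s'"
      by (subst (asm) ennreal_le_iff) (use t in auto)
    then show ?thesis by simp
  qed
  have p: "?p s = \<gamma> t" if t: "t \<in> {a..b}" "curve_length \<gamma> a t = ennreal s" "0 \<le> s" for t s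
    unfolding arclength_param_def
  proof (rule the_equality)
    fix x assume "\<exists>t\<in>{a..b}. curve_length \<gamma> a t = ennreal s \<and> \<gamma> t = x"
    then obtain t' where t': "t' \<in> {a..b}" "curve_length \<gamma> a t' = ennreal s" "\<gamma> t' = x" by blast
    show "x = \<gamma> t"
    proof (cases "t \<le> t'")
      case True
      then show ?thesis using close[OF t(1) t'(1) t(2) t'(2) t(3) t(3)] t'(3) by simp
    next
      case False
      then show ?thesis using close[OF t'(1) t(1) t'(2) t(2) t(3) t(3)] t'(3) by simp
    qed
  qed (use t in blast)
  have ex: "\<exists>t\<in>{a..b}. curve_length \<gamma> a t = ennreal s" if "s \<in> {0..L}" for s
  proof -
    have "curve_length \<gamma> a a \<le> ennreal s" by simp
    moreover have "ennreal s \<le> curve_length \<gamma> a b"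
      unfolding L'(1)[symmetric] using that by (intro ennreal_leI) simp
    ultimately obtain t where "a \<le> t" "t \<le> b" "curve_length \<gamma> a t = ennreal s"
      using IVT'[OF _ _ ab continuous_on_curve_length[OF cont fin]] by blast
    then show ?thesis by auto
  qed
  have lip: "dist (?p s) (?p s') \<le> \<bar>s' - s\<bar>" if ss: "s \<in> {0..L}" "s' \<in> {0..L}" for s s'
  proof -
    obtain t t' where t: "t \<in> {a..b}" "curve_length \<gamma> a t = ennreal s"
      "t' \<in> {a..b}" "curve_length \<gamma> a t' = ennreal s'"
      using ex[OF ss(1)] ex[OF ss(2)] by blast
    have s0: "0 \<le> s" "0 \<le> s'" using ss by auto
    have "dist (\<gamma> t) (\<gamma> t') \<le> \<bar>s' - s\<bar>"
    proof (cases "t \<le> t'")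
      case True
      then show ?thesis using close[OF t(1,3,2,4) s0] by simp
    next
      case False
      then show ?thesis using close[OF t(3,1,4,2) s0(2,1)] by (simp add: dist_commute)
    qed
    then show ?thesis using p[OF t(1,2) s0(1)] p[OF t(3,4) s0(2)] by simp
  qed
  define q where "q s = ?p (max 0 (min L s))" for s
  show thesis
  proof (rule that)
    show "1-lipschitz_on UNIV q"
    proof (rule lipschitz_onI)
      fix s s' :: real
      have "dist (q s) (q s') \<le> \<bar>max 0 (min L s') - max 0 (min L s)\<bar>"
        unfolding q_def using L' by (intro lip) auto
      also have "\<dots> \<le> \<bar>s' - s\<bar>" by (auto simp: min_def max_def)
      finally show "dist (q s) (q s') \<le> 1 * dist s s'" by (simp add: dist_real_def abs_minus_commute)
    qed simp
    show "q 0 = \<gamma> a" using p[of a 0] ab L' by (simp add: q_def)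
    show "q L = \<gamma> b" using p[of b L] ab L' by (simp add: q_def)
    show "\<forall>s\<in>{0..L}. ?p s = q s" by (simp add: q_def)
  qed
qed

lemma curve_length_pos:
  assumes "\<not> \<gamma> constant_on {a..b}"
  shows "curve_length \<gamma> a b > 0"
proof (rule ccontr)
  assume "\<not> curve_length \<gamma> a b > 0"
  then have 0: "curve_length \<gamma> a b = 0" by simp
  have "\<gamma> t = \<gamma> a" if "t \<in> {a..b}" for t
    using dist_le_curve_length[of a t \<gamma>] curve_length_mono(1)[of a t b \<gamma>] that 0 by auto
  then show False using assms unfolding constant_on_def by blast
qed

section \<open>Upper gradients\<close>

theorem theorem3p2:
  fixes \<mu> :: "'a::metric_space set \<Rightarrow> ennreal"
    and u :: "'a \<Rightarrow> real"
    and g :: "'a \<Rightarrow> ennreal"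
  assumes "borel_regular_measure \<mu>"
    and "\<mu> UNIV \<noteq> 0"
    and "\<And>A. bounded A \<Longrightarrow> \<mu> A < \<infinity>"
    and "\<And>U. open U \<Longrightarrow> U \<noteq> {} \<Longrightarrow> \<mu> U > 0"
    and "separable_space (euclidean :: 'a topology)"
    and "locally_integrable (caratheodory_measure \<mu>) u"
    and "locally_integrable_ennreal (caratheodory_measure \<mu>) g"
    and "local_Hajlasz_gradient (caratheodory_measure \<mu>) g u"
  shows "\<exists>(u' :: 'a \<Rightarrow> real) (g' :: 'a \<Rightarrow> ennreal).
           locally_integrable (caratheodory_measure \<mu>) u' \<and>
           locally_integrable_ennreal (caratheodory_measure \<mu>) g' \<and>
           (AE x in caratheodory_measure \<mu>. u' x = u x) \<and>
           (AE x in caratheodory_measure \<mu>. g' x = g x) \<and>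
           upper_gradient (caratheodory_measure \<mu>) (\<lambda>x. 4 * g' x) u'"
proof -
  let ?M = "caratheodory_measure \<mu>"
  note M = caratheodory_measure_borel_regular[OF assms(1)]
  interpret complete_measure ?M by (rule M(4))
  have bounded: "emeasure ?M A < \<infinity>" if "bounded A" "A \<in> sets ?M" for A
    using that M(2) assms(3) by simp
  obtain g' where g': "g' \<in> borel_measurable borel" "everywhere_local_Hajlasz g' u"
    "AE x in ?M. g' x = g x \<and> g' x < \<infinity>"
    using exists_everywhere_local_Hajlasz[OF space_caratheodory_measure M(1,3) bounded assms(5,7,8)] .
  obtain u' where u': "\<forall>x. g' x < \<infinity> \<longrightarrow> u' x = u x"
    "\<forall>(p :: real \<Rightarrow> 'a) L. 1-lipschitz_on UNIV p \<and> L > 0 \<longrightarrow>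
       ennreal \<bar>u' (p 0) - u' (p L)\<bar> \<le> 4 * (\<integral>\<^sup>+s\<in>{0..L}. g' (p s) \<partial>lborel)"
    using Hajlasz_representative_of_function[OF g'(1,2)] by (elim exE conjE)
  have u_eq: "AE x in ?M. u' x = u x"
    using g'(3) by eventually_elim (use u'(1) in blast)
  have g_eq: "AE x in ?M. g' x = g x"
    using g'(3) by eventually_elim simp
  \<comment> \<open>The function \<open>u'\<close> was chosen point by point, so its measurability
    comes only from agreeing almost everywhere with \<open>u\<close>.\<close>
  have u'_meas: "u' \<in> borel_measurable ?M"
  proof (rule measurable_AE_eq)
    show "u \<in> borel_measurable ?M" using assms(6) by (simp add: locally_integrable_def)
  qed (use u_eq in auto)
  have g'_meas: "g' \<in> borel_measurable ?M"
    by (rule measurable_compose[OF id_measurable_borel[OF space_caratheodory_measure M(1,3) bounded] g'(1)])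
  have "set_integrable ?M (ball x r) u'" if "set_integrable ?M (ball x r) u" for x r
    unfolding set_integrable_def
  proof (rule integrable_cong_AE_imp)
    show "integrable ?M (\<lambda>x'. indicator (ball x r) x' *\<^sub>R u x')"
      using that by (simp add: set_integrable_def)
    have "ball x r \<in> sets ?M" using M(1) borel_open[OF open_ball] by blast
    then show "(\<lambda>x'. indicator (ball x r) x' *\<^sub>R u' x') \<in> borel_measurable ?M"
      using u'_meas by measurable
    show "AE x' in ?M. indicator (ball x r) x' *\<^sub>R u x' = indicator (ball x r) x' *\<^sub>R u' x'"
      using u_eq by eventually_elim simp
  qed
  then have u'_int: "locally_integrable ?M u'"
    using assms(6) u'_meas unfolding locally_integrable_def by blast
  have "(\<integral>\<^sup>+y\<in>ball x r. g' y \<partial>?M) = (\<integral>\<^sup>+y\<in>ball x r. g y \<partial>?M)" for x r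
    using g_eq by (intro nn_integral_cong_AE, eventually_elim) simp
  then have g'_int: "locally_integrable_ennreal ?M g'"
    using assms(7) g'_meas by (simp add: locally_integrable_ennreal_def)
  have "ennreal \<bar>u' (\<gamma> a) - u' (\<gamma> b)\<bar> \<le> arclength_integral (\<lambda>x. 4 * g' x) \<gamma> a b"
    if rect: "rectifiable_curve \<gamma> a b" and nonconst: "\<not> \<gamma> constant_on {a..b}" for \<gamma> a b
  proof -
    define L where "L = enn2real (curve_length \<gamma> a b)"
    obtain q where q: "1-lipschitz_on UNIV q" "q 0 = \<gamma> a" "q L = \<gamma> b"
      "\<forall>s\<in>{0..L}. arclength_param \<gamma> a b s = q s"
      using arclength_param_lipschitz_extension[OF rect L_def] .
    have [measurable]: "q \<in> borel_measurable borel"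
      using q(1) by (intro borel_measurable_continuous_onI lipschitz_on_continuous_on)
    note [measurable] = g'(1)
    \<comment> \<open>This is where non-constancy of the curve enters; finiteness of its length
      makes \<open>enn2real\<close> faithful.\<close>
    have "L > 0"
      using curve_length_pos[OF nonconst] rect by (simp add: L_def rectifiable_curve_def enn2real_positive_iff)
    then have "ennreal \<bar>u' (\<gamma> a) - u' (\<gamma> b)\<bar> \<le> 4 * (\<integral>\<^sup>+s\<in>{0..L}. g' (q s) \<partial>lborel)"
      using u'(2) q(1-3) by metis
    also have "\<dots> = (\<integral>\<^sup>+s. 4 * (g' (q s) * indicator {0..L} s) \<partial>lborel)"
      by (rule nn_integral_cmult[symmetric]) measurable
    also have "\<dots> = arclength_integral (\<lambda>x. 4 * g' x) \<gamma> a b"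
      unfolding arclength_integral_def L_def[symmetric]
      by (intro nn_integral_cong) (simp add: q(4) mult.assoc indicator_def)
    finally show ?thesis .
  qed
  moreover have "(\<lambda>x. 4 * g' x) \<in> borel_measurable borel"
    using g'(1) by measurable
  ultimately have "upper_gradient ?M (\<lambda>x. 4 * g' x) u'"
    using u'_meas by (simp add: upper_gradient_def)
  then show ?thesis
    using u'_int g'_int u_eq g_eq by blast
qed

end
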